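(* Let $W$ be a vector space, let $a,b\in\mathrm{LFie}(W)$ be two local logarithmic fields, and let $N\ge0$ be an integer such that $z_{12}^N a(z_1)b(z_2)=z_{12}^N b(z_2)a(z_1)$. Then for $0\le n\le N-1$ and $k\ge0$ we have $$(a_{(n)}b)(z)=D_{z_1}^{(N-1-n)}\bigl(z_{12}^N P(a,b;z_1,z_2)\bigr)\big|_{z_1=z_2=z},$$ $$(a_{(-k-1)}b)(z)={:}\bigl(D_z^{(k)}a(z)\bigr)b(z){:}+D_{z_1}^{(N+k)}\bigl(z_{12}^N P(a,b;z_1,z_2)\bigr)\big|_{z_1=z_2=z}.$$
   Context: All vector spaces are over $\mathbb C$; $D^{(k)}=D^k/k!$ for an operator $D$. $z,z_1,z_2,\dots$ are commuting formal variables, $\zeta,\zeta_1,\zeta_2,\dots$ are further formal variables (thought of as $\zeta=\log z$, $\zeta_i=\log z_i$), and $z_{ij}=z_i-z_j$. Put $D_z=\partial_z+z^{-1}\partial_\zeta$, and similarly $D_{z_i}$. Setting $z_1=z_2=z$ is understood to also set $\zeta_1=\zeta_2=\zeta$. For a vector space $W$ and $\alpha\in\mathbb C/\mathbb Z$, $W[\zeta][[z]]z^{-\alpha}$ is the space of formal series $\sum_{i\ge0}w_i(\zeta)z^{i-m}$ with $w_i(\zeta)\in W[\zeta]$, $m\in\alpha$. Let $\mathrm{LFie}_\alpha(W)=\mathrm{Hom}_{\mathbb C}(W,W[\zeta][[z]]z^{-\alpha})$ and $\mathrm{LFie}(W)=\bigoplus_{\alpha\in\mathbb C/\mathbb Z}\mathrm{LFie}_\alpha(W)$;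 its elements, written $a(z)$ or $a(\zeta,z)$, are called logarithmic fields. Two logarithmic fields are local if $z_{12}^N a(z_1)b(z_2)=z_{12}^N b(z_2)a(z_1)$ for some integer $N\ge0$. For local $a,b$ and $n\in\mathbb Z$, the $n$-th product is $(a_{(n)}b)(z)v=D_{z_1}^{(N-1-n)}\bigl(z_{12}^N a(z_1)b(z_2)v\bigr)\big|_{z_1=z_2=z}$ ($v\in W$) for $n\le N-1$, and $a_{(n)}b=0$ for $n\ge N$ (independent of the choice of $N$). For a logarithmic field $a(z)$, the annihilation part $a(z)_-$ is the part of $a(z)$ containing only powers $z^\gamma$ with $\mathrm{Re}\,\gamma<0$, and the creation part $a(z)_+$ is the part containing only $z^\gamma$ with $\mathrm{Re}\,\gamma\ge0$. The normally ordered product is ${:}a(z_1)b(z_2){:}=a(z_1)_+b(z_2)+b(z_2)a(z_1)_-$ (it is well defined at $z_1=z_2$, and ${:}a(z)b(z){:}$ is again a logarithmic field). The propagator is $P(a,b;z_1,z_2)=[a(z_1)_-,b(z_2)]=a(z_1)b(z_2)-{:}a(z_1)b(z_2){:}$.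
   Formalization: In the second formula the normally ordered term is read as (D^(k)(a_+))b + b(D^(k)(a_-)), D^(k) applied after splitting a; splitting D^(k)a anew makes the claim false (twisted boson a=b, N=2, k=1: off by (3/4)z^(-3)). They agree for k=0 and for integer powers without ζ. *)

theory Defs
  imports Complex_Main "HOL-Library.Function_Algebras" "HOL-Library.Groups_Big_Fun"
begin

text \<open>
  The vector space is the type \<open>'w\<close> with scalar multiplication \<open>s :: complex \<Rightarrow> 'w \<Rightarrow> 'w\<close>.
  Formal series are given by their coefficients: \<open>f \<gamma> k\<close> is the coefficient of
  \<open>z\<close> to the power \<open>\<gamma>\<close> times \<open>\<zeta>\<close> to the power \<open>k\<close>, and \<open>F \<gamma>1 k1 \<gamma>2 k2\<close> is the coefficient of
  \<open>z1^\<gamma>1 \<zeta>1^k1 z2^\<gamma>2 \<zeta>2^k2\<close>.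
\<close>

type_synonym 'w series = "complex \<Rightarrow> nat \<Rightarrow> 'w"
type_synonym 'w series2 = "complex \<Rightarrow> nat \<Rightarrow> complex \<Rightarrow> nat \<Rightarrow> 'w"
type_synonym 'w field1 = "'w \<Rightarrow> 'w series"
type_synonym 'w field2 = "'w \<Rightarrow> 'w series2"

definition CmodZ :: "complex set set" where
  "CmodZ = UNIV // {(x, y). x - y \<in> \<int>}"

text \<open>The space \<open>W[\<zeta>][[z]]z^(-\<alpha>)\<close>, for a coset \<open>\<alpha>\<close> of the integers.\<close>

definition log_series :: "complex set \<Rightarrow> 'w::zero series set" where
  "log_series \<alpha> = {f. (\<exists>m\<in>\<alpha>. \<forall>\<gamma> k. f \<gamma> k \<noteq> 0 \<longrightarrow> (\<exists>i::nat. \<gamma> = of_nat i - m)) \<and>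
                      (\<forall>\<gamma>. finite {k. f \<gamma> k \<noteq> 0})}"

definition LFie_at :: "(complex \<Rightarrow> 'w::ab_group_add \<Rightarrow> 'w) \<Rightarrow> complex set \<Rightarrow> 'w field1 set" where
  "LFie_at s \<alpha> = {a. Vector_Spaces.linear s (\<lambda>c f \<gamma> k. s c (f \<gamma> k)) a \<and> (\<forall>v. a v \<in> log_series \<alpha>)}"

text \<open>The direct sum over \<open>\<alpha>\<close> is taken inside the space of all maps from \<open>W\<close> to formal series;
  its summands are independent because series for distinct \<open>\<alpha>\<close> have disjoint sets of exponents.\<close>

definition LFie :: "(complex \<Rightarrow> 'w::ab_group_add \<Rightarrow> 'w) \<Rightarrow> 'w field1 set" where
  "LFie s = {a. \<exists>A f. finite A \<and> A \<subseteq> CmodZ \<and> (\<forall>\<alpha>\<in>A. f \<alpha> \<in> LFie_at s \<alpha>) \<and> a = (\<Sum>\<alpha>\<in>A. f \<alpha>)}"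

text \<open>\<open>D = \<partial>\<^sub>z + z\<^sup>-\<^sup>1 \<partial>\<^sub>\<zeta>\<close> sends \<open>z^\<gamma> \<zeta>^k\<close> to \<open>\<gamma> z^(\<gamma>-1) \<zeta>^k + k z^(\<gamma>-1) \<zeta>^(k-1)\<close>.\<close>

definition Dz :: "(complex \<Rightarrow> 'w::plus \<Rightarrow> 'w) \<Rightarrow> 'w series \<Rightarrow> 'w series" where
  "Dz s f = (\<lambda>\<gamma> k. s (\<gamma> + 1) (f (\<gamma> + 1) k) + s (of_nat (k + 1)) (f (\<gamma> + 1) (k + 1)))"

definition Dz1 :: "(complex \<Rightarrow> 'w::plus \<Rightarrow> 'w) \<Rightarrow> 'w series2 \<Rightarrow> 'w series2" where
  "Dz1 s F = (\<lambda>\<gamma>1 k1 \<gamma>2 k2. Dz s (\<lambda>\<gamma> k. F \<gamma> k \<gamma>2 k2) \<gamma>1 k1)"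

definition Dz_div :: "(complex \<Rightarrow> 'w::plus \<Rightarrow> 'w) \<Rightarrow> nat \<Rightarrow> 'w series \<Rightarrow> 'w series" where
  "Dz_div s n f = (\<lambda>\<gamma> k. s (1 / fact n) ((Dz s ^^ n) f \<gamma> k))"

definition Dz1_div :: "(complex \<Rightarrow> 'w::plus \<Rightarrow> 'w) \<Rightarrow> nat \<Rightarrow> 'w series2 \<Rightarrow> 'w series2" where
  "Dz1_div s n F = (\<lambda>\<gamma>1 k1 \<gamma>2 k2. s (1 / fact n) ((Dz1 s ^^ n) F \<gamma>1 k1 \<gamma>2 k2))"

text \<open>Multiplication by \<open>z1 - z2\<close>.\<close>

definition mult_z12 :: "'w::minus series2 \<Rightarrow> 'w series2" where
  "mult_z12 F = (\<lambda>\<gamma>1 k1 \<gamma>2 k2. F (\<gamma>1 - 1) k1 \<gamma>2 k2 - F \<gamma>1 k1 (\<gamma>2 - 1) k2)"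

text \<open>Setting \<open>z1 = z2 = z\<close> and \<open>\<zeta>1 = \<zeta>2 = \<zeta>\<close>. This makes sense when, for all \<open>\<gamma>\<close> and all \<open>i, j\<close>, only
  finitely many \<open>\<gamma>1\<close> satisfy \<open>F \<gamma>1 i (\<gamma> - \<gamma>1) j \<noteq> 0\<close>; \<open>Sum_any\<close> has a junk value otherwise.
  The condition holds wherever \<open>diag\<close> is applied below to series coming from local
  logarithmic fields: their exponents \<open>\<gamma>1, \<gamma>2\<close> lie in finitely many cosets of the integers and
  have real parts bounded below.\<close>

definition diag :: "'w::comm_monoid_add series2 \<Rightarrow> 'w series" where
  "diag F = (\<lambda>\<gamma> k. \<Sum>i\<le>k. Sum_any (\<lambda>\<gamma>1. F \<gamma>1 i (\<gamma> - \<gamma>1) (k - i)))"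

text \<open>\<open>prod12 a b\<close> is \<open>a(z1) b(z2)\<close> and \<open>prod21 b a\<close> is \<open>b(z2) a(z1)\<close>.\<close>

definition prod12 :: "'w field1 \<Rightarrow> 'w field1 \<Rightarrow> 'w field2" where
  "prod12 a b v = (\<lambda>\<gamma>1 k1 \<gamma>2 k2. a (b v \<gamma>2 k2) \<gamma>1 k1)"

definition prod21 :: "'w field1 \<Rightarrow> 'w field1 \<Rightarrow> 'w field2" where
  "prod21 b a v = (\<lambda>\<gamma>1 k1 \<gamma>2 k2. b (a v \<gamma>1 k1) \<gamma>2 k2)"

definition local_with :: "nat \<Rightarrow> 'w::minus field1 \<Rightarrow> 'w field1 \<Rightarrow> bool" where
  "local_with N a b \<longleftrightarrow> (\<forall>v. (mult_z12 ^^ N) (prod12 a b v) = (mult_z12 ^^ N) (prod21 b a v))"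

definition mutually_local :: "'w::minus field1 \<Rightarrow> 'w field1 \<Rightarrow> bool" where
  "mutually_local a b \<longleftrightarrow> (\<exists>N. local_with N a b)"

text \<open>The \<open>n\<close>-th product does not depend on the exponent \<open>N\<close>, which is therefore chosen arbitrarily.\<close>

definition nth_product ::
  "(complex \<Rightarrow> 'w::ab_group_add \<Rightarrow> 'w) \<Rightarrow> 'w field1 \<Rightarrow> 'w field1 \<Rightarrow> int \<Rightarrow> 'w field1" where
  "nth_product s a b n =
     (let N = (SOME N. local_with N a b) in
      if n \<le> int N - 1
      then (\<lambda>v. diag (Dz1_div s (nat (int N - 1 - n)) ((mult_z12 ^^ N) (prod12 a b v))))
      else 0)"

definition annihilation :: "'w::zero field1 \<Rightarrow> 'w field1" where
  "annihilation a v = (\<lambda>\<gamma> k. if Re \<gamma> < 0 then a v \<gamma> k else 0)"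

definition creation :: "'w::zero field1 \<Rightarrow> 'w field1" where
  "creation a v = (\<lambda>\<gamma> k. if Re \<gamma> \<ge> 0 then a v \<gamma> k else 0)"

text \<open>\<open>:(D^(k) a(z1)) b(z2):\<close>, where \<open>D^(k)\<close> acts on the two parts of \<open>a\<close> inside the normal ordering,
  so that it equals \<open>D^(k)\<close> in \<open>z1\<close> applied to \<open>:a(z1) b(z2):\<close>. Splitting the field
  \<open>D^(k) a\<close> itself gives something else in general: \<open>D\<close> maps \<open>z^(1/2)\<close> and \<open>\<zeta>\<close>, which are in
  the creation part, to multiples of \<open>z^(-1/2)\<close> and \<open>z^(-1)\<close>. The two agree for \<open>k = 0\<close> and for fields
  with integer exponents and no \<open>\<zeta>\<close>.\<close>

definition normal_prod_deriv ::
  "(complex \<Rightarrow> 'w::ab_group_add \<Rightarrow> 'w) \<Rightarrow> nat \<Rightarrow> 'w field1 \<Rightarrow> 'w field1 \<Rightarrow> 'w field2" where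
  "normal_prod_deriv s k a b v =
     prod12 (\<lambda>w. Dz_div s k (creation a w)) b v + prod21 b (\<lambda>w. Dz_div s k (annihilation a w)) v"

definition normal_prod :: "'w::ab_group_add field1 \<Rightarrow> 'w field1 \<Rightarrow> 'w field2" where
  "normal_prod a b v = prod12 (creation a) b v + prod21 b (annihilation a) v"

definition propagator :: "'w::ab_group_add field1 \<Rightarrow> 'w field1 \<Rightarrow> 'w field2" where
  "propagator a b v = prod12 (annihilation a) b v - prod21 b (annihilation a) v"

lemma propagator_eq: "propagator a b v = prod12 a b v - normal_prod a b v"
  by (auto simp: propagator_def normal_prod_def prod12_def annihilation_def creation_def fun_eq_iff)

locale complex_vector_space = vector_space scale
  for scale :: "complex \<Rightarrow> 'w::ab_group_add \<Rightarrow> 'w"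
begin

lemma funpow_Dz1_normal_prod_deriv:
  assumes b: "\<And>\<gamma> j. Vector_Spaces.linear scale scale (\<lambda>w. b w \<gamma> j)"
  shows "(Dz1 scale ^^ k) (prod12 p b v + prod21 b m v) =
         prod12 (\<lambda>w. (Dz scale ^^ k) (p w)) b v + prod21 b (\<lambda>w. (Dz scale ^^ k) (m w)) v"
proof (induction k)
  case (Suc k)
  have add: "b (x + y) \<gamma> j = b x \<gamma> j + b y \<gamma> j" for x y \<gamma> j
    using module_hom.add[OF b[of \<gamma> j, unfolded linear_iff_module_hom]] .
  have mul: "b (scale c x) \<gamma> j = scale c (b x \<gamma> j)" for c x \<gamma> j
    using module_hom.scale[OF b[of \<gamma> j, unfolded linear_iff_module_hom]] .
  show ?case
    unfolding funpow.simps o_apply Suc.IH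
    by (simp add: Dz1_def Dz_def prod12_def prod21_def add mul
        fun_eq_iff scale_right_distrib algebra_simps)
qed simp

lemma Dz1_div_normal_prod:
  assumes b: "\<And>\<gamma> j. Vector_Spaces.linear scale scale (\<lambda>w. b w \<gamma> j)"
  shows "Dz1_div scale k (normal_prod a b v) = normal_prod_deriv scale k a b v"
proof -
  have mul: "b (scale c x) \<gamma> j = scale c (b x \<gamma> j)" for c x \<gamma> j
    using module_hom.scale[OF b[of \<gamma> j, unfolded linear_iff_module_hom]] .
  show ?thesis
    unfolding Dz1_div_def normal_prod_def funpow_Dz1_normal_prod_deriv[OF b]
    by (simp add: normal_prod_deriv_def prod12_def prod21_def Dz_div_def fun_eq_iff
        scale_right_distrib mul)
qed

lemma funpow_Dz_no_zeta:
  assumes "\<And>\<gamma> j. j > 0 \<Longrightarrow> f \<gamma> j = 0"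
  shows "(Dz scale ^^ k) f \<gamma> j = scale (pochhammer (\<gamma> + 1) k) (f (\<gamma> + of_nat k) j)"
proof (induction k arbitrary: \<gamma> j)
  case (Suc k)
  show ?case
    by (simp add: Dz_def[of scale "(Dz scale ^^ k) f"] Suc.IH assms pochhammer_rec add_ac)
qed simp

lemma normal_prod_deriv_integral:
  assumes int: "\<And>w \<gamma> j. a w \<gamma> j \<noteq> 0 \<Longrightarrow> \<gamma> \<in> \<int> \<and> j = 0"
  shows "normal_prod_deriv scale k a b = normal_prod (\<lambda>w. Dz_div scale k (a w)) b"
proof -
  have zeta: "a w \<gamma> j = 0" if "j > 0" for w \<gamma> j
    using int[of w \<gamma> j] that by auto
  have D: "(Dz scale ^^ k) (a w) \<gamma> j = scale (pochhammer (\<gamma> + 1) k) (a w (\<gamma> + of_nat k) j)"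
    "(Dz scale ^^ k) (creation a w) \<gamma> j = scale (pochhammer (\<gamma> + 1) k) (creation a w (\<gamma> + of_nat k) j)"
    "(Dz scale ^^ k) (annihilation a w) \<gamma> j = scale (pochhammer (\<gamma> + 1) k) (annihilation a w (\<gamma> + of_nat k) j)"
    for w \<gamma> j
    by (rule funpow_Dz_no_zeta, simp add: zeta creation_def annihilation_def)+
  have poch: "pochhammer (\<gamma> + 1) k = 0"
    if "a w (\<gamma> + of_nat k) j \<noteq> 0" "Re \<gamma> < 0" "Re \<gamma> + real k \<ge> 0" for w \<gamma> j
  proof -
    have "\<gamma> + of_nat k \<in> \<int>" using int that by blast
    then obtain i where "\<gamma> + of_nat k = of_int i" by (rule Ints_cases)
    then have g: "\<gamma> = of_int (i - int k)" by (simp add: eq_diff_eq)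
    with that have "i - int k < 0" "i \<ge> 0" by auto
    with g have "\<gamma> + 1 = - of_nat (nat (int k - i - 1))" "nat (int k - i - 1) < k"
      by (auto simp: of_nat_nat)
    then show ?thesis by (metis pochhammer_of_nat_eq_0_lemma)
  qed
  have "Dz_div scale k (creation a w) = creation (\<lambda>w. Dz_div scale k (a w)) w"
    "Dz_div scale k (annihilation a w) = annihilation (\<lambda>w. Dz_div scale k (a w)) w" for w
    unfolding Dz_div_def D fun_eq_iff
    using poch[of w] by (auto simp: Dz_div_def D(1) creation_def annihilation_def)
      (metis not_le)+
  then show ?thesis
    by (intro ext) (simp add: normal_prod_deriv_def normal_prod_def prod12_def prod21_def)
qed

lemma normal_prod_deriv_0: "normal_prod_deriv scale 0 = normal_prod"
  by (simp add: fun_eq_iff normal_prod_deriv_def normal_prod_def Dz_div_def)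

end

end

theory Submission
  imports Defs
begin

text \<open>
  Let \<open>D = \<partial>\<^sub>z + z\<^sup>-\<^sup>1 \<partial>\<^sub>\<zeta>\<close> act in the variable \<open>z1\<close>, with divided powers \<open>D^(m)\<close>. Everything follows from the commutation rule
  \<open>D^(m+1) z12 = z12 D^(m+1) + D^(m)\<close> (\<open>Dz1_div_Suc_mult_z12\<close>) and from the fact that a multiple of
  \<open>z12\<close> vanishes on the diagonal (\<open>diag_mult_z12\<close>). Together they say that on the diagonal
  \<open>D^(m+j) z12^j F\<close> and \<open>D^(m) F\<close> agree, and that \<open>D^(m) z12^j F\<close> is zero for \<open>m < j\<close>.

  With \<open>F = z12^M a(z1) b(z2)\<close> this shows that the \<open>n\<close>-th product is the same for every exponent \<open>N\<close>
  realising locality. With \<open>F\<close> the normally ordered product it evaluates one of the two terms of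
  \<open>a(z1) b(z2) = P(a,b;z1,z2) + :a(z1) b(z2):\<close>: the normally ordered term contributes
  \<open>D^(N-1-n) z12^N :a(z1) b(z2):\<close> on the diagonal, which is zero for \<open>n \<ge> 0\<close> and is
  \<open>D^(k) :a(z1) b(z2):\<close> for \<open>n = -k-1\<close>. As \<open>b\<close> is linear, \<open>D^(k)\<close> passes to \<open>a\<close>
  inside the normal ordering.

  It remains to see that restriction to the diagonal makes sense, that is, that the sums
  over \<open>\<gamma>1 + \<gamma>2 = \<gamma>\<close> are finite. For \<open>z12^N a(z1) b(z2)\<close> this is where locality enters: one
  ordering bounds the exponents of \<open>z2\<close> from below, the other those of \<open>z1\<close>
  (\<open>diagonal_finite_local\<close>). The normally ordered product has this property by construction
  (\<open>diagonal_finite_normal_prod\<close>), and hence so does the propagator times \<open>z12^N\<close>.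
\<close>

section \<open>Restriction to the diagonal\<close>

definition diagonal_finite :: "'w::zero series2 \<Rightarrow> bool" where
  "diagonal_finite F \<longleftrightarrow> (\<forall>\<gamma> i j. finite {\<gamma>1. F \<gamma>1 i (\<gamma> - \<gamma>1) j \<noteq> 0})"

lemma diagonal_finite_add:
  fixes F G :: "'w::ab_group_add series2"
  assumes "diagonal_finite F" "diagonal_finite G"
  shows "diagonal_finite (F + G)"
  unfolding diagonal_finite_def
proof (intro allI)
  fix \<gamma> i j
  have "{\<gamma>1. (F + G) \<gamma>1 i (\<gamma> - \<gamma>1) j \<noteq> 0}
      \<subseteq> {\<gamma>1. F \<gamma>1 i (\<gamma> - \<gamma>1) j \<noteq> 0} \<union> {\<gamma>1. G \<gamma>1 i (\<gamma> - \<gamma>1) j \<noteq> 0}"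
    by auto
  then show "finite {\<gamma>1. (F + G) \<gamma>1 i (\<gamma> - \<gamma>1) j \<noteq> 0}"
    using assms unfolding diagonal_finite_def by (meson finite_Un finite_subset)
qed

lemma diagonal_finite_minus:
  fixes F G :: "'w::ab_group_add series2"
  assumes "diagonal_finite F" "diagonal_finite G"
  shows "diagonal_finite (F - G)"
proof -
  have "diagonal_finite (- G)"
    using assms(2) by (simp add: diagonal_finite_def)
  then show ?thesis
    using diagonal_finite_add[OF assms(1)] by fastforce
qed

lemma finite_shifted:
  fixes P :: "complex \<Rightarrow> bool"
  assumes "finite {x. P x}"
  shows "finite {x. P (x + c)}"
proof -
  have "{x. P (x + c)} \<subseteq> (\<lambda>x. x - c) ` {x. P x}"
    by (auto intro!: image_eqI[where x = "_ + c"])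
  then show ?thesis
    using assms finite_surj by blast
qed

lemma diagonal_finite_shift:
  assumes "diagonal_finite F"
  shows "finite {\<gamma>1. F (\<gamma>1 + c) i (\<gamma> - \<gamma>1) j \<noteq> 0}"
  using finite_shifted[of "\<lambda>x. F x i (\<gamma> + c - x) j \<noteq> 0" c] assms
  by (auto simp: diagonal_finite_def algebra_simps)

lemma diagonal_finite_mult_z12:
  fixes F :: "'w::ab_group_add series2"
  assumes "diagonal_finite F"
  shows "diagonal_finite (mult_z12 F)"
  unfolding diagonal_finite_def
proof (intro allI)
  fix \<gamma> i j
  have "{\<gamma>1. mult_z12 F \<gamma>1 i (\<gamma> - \<gamma>1) j \<noteq> 0} \<subseteq>
      {\<gamma>1. F (\<gamma>1 + (- 1)) i (\<gamma> - \<gamma>1) j \<noteq> 0} \<union> {\<gamma>1. F (\<gamma>1 + 0) i (\<gamma> - 1 - \<gamma>1) j \<noteq> 0}"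
    by (auto simp: mult_z12_def algebra_simps)
  then show "finite {\<gamma>1. mult_z12 F \<gamma>1 i (\<gamma> - \<gamma>1) j \<noteq> 0}"
    using diagonal_finite_shift[OF assms] by (meson finite_Un finite_subset)
qed

lemma diagonal_finite_mult_z12_power:
  fixes F :: "'w::ab_group_add series2"
  assumes "diagonal_finite F"
  shows "diagonal_finite ((mult_z12 ^^ n) F)"
  by (induction n) (simp_all add: assms diagonal_finite_mult_z12)

lemma diag_add:
  fixes F G :: "'w::ab_group_add series2"
  assumes "diagonal_finite F" "diagonal_finite G"
  shows "diag (F + G) = diag F + diag G"
  using assms unfolding diagonal_finite_def
  by (simp add: diag_def fun_eq_iff Sum_any.distrib sum.distrib)

text \<open>
  On the diagonal, multiplication by \<open>z1\<close> and by \<open>z2\<close> are the same up to the reindexing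
  \<open>\<gamma>1 \<mapsto> \<gamma>1 - 1\<close> of the sum.
\<close>

lemma diag_mult_z12:
  fixes F :: "'w::ab_group_add series2"
  assumes "diagonal_finite F"
  shows "diag (mult_z12 F) = 0"
proof -
  have "Sum_any (\<lambda>\<gamma>1. mult_z12 F \<gamma>1 i (\<gamma> - \<gamma>1) j) = 0" for \<gamma> i j
  proof -
    define g where "g \<gamma>1 = F \<gamma>1 i (\<gamma> - 1 - \<gamma>1) j" for \<gamma>1
    define h where "h \<gamma>1 = mult_z12 F \<gamma>1 i (\<gamma> - \<gamma>1) j" for \<gamma>1
    have fin: "finite {\<gamma>1. g \<gamma>1 \<noteq> 0}" "finite {\<gamma>1. h \<gamma>1 \<noteq> 0}"
      using assms diagonal_finite_mult_z12[OF assms]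
      by (simp_all add: g_def h_def diagonal_finite_def)
    have bij: "bij (\<lambda>x::complex. x - 1)"
      by (rule bij_betw_byWitness[where f' = "\<lambda>x. x + 1"]) auto
    have "h \<gamma>1 + g \<gamma>1 = g (\<gamma>1 - 1)" for \<gamma>1
      by (simp add: g_def h_def mult_z12_def algebra_simps)
    then have "Sum_any h + Sum_any g = Sum_any (\<lambda>\<gamma>1. g (\<gamma>1 - 1))"
      using Sum_any.distrib[OF fin(2,1)] by simp
    also have "\<dots> = Sum_any g"
      by (rule Sum_any.reindex_cong[OF bij, symmetric]) (simp add: comp_def)
    finally show ?thesis
      by (simp add: h_def[abs_def])
  qed
  then show ?thesis
    by (simp add: diag_def fun_eq_iff)
qed

section \<open>Divided powers of the derivation and multiplication by \<open>z1 - z2\<close>\<close>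

lemma mult_z12_add: "mult_z12 (F + G) = mult_z12 F + mult_z12 G" for F :: "'w::ab_group_add series2"
  by (simp add: mult_z12_def fun_eq_iff)

lemma mult_z12_power_add:
  "(mult_z12 ^^ n) (F + G) = (mult_z12 ^^ n) F + (mult_z12 ^^ n) G" for F :: "'w::ab_group_add series2"
  by (induction n) (simp_all only: funpow.simps id_apply o_apply mult_z12_add)

context complex_vector_space
begin

lemma Dz1_add: "Dz1 scale (F + G) = Dz1 scale F + Dz1 scale G"
  by (simp add: Dz1_def Dz_def fun_eq_iff scale_right_distrib algebra_simps)

lemma Dz1_power_add: "(Dz1 scale ^^ n) (F + G) = (Dz1 scale ^^ n) F + (Dz1 scale ^^ n) G"
  by (induction n) (simp_all only: funpow.simps id_apply o_apply Dz1_add)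

lemma Dz1_div_add: "Dz1_div scale n (F + G) = Dz1_div scale n F + Dz1_div scale n G"
  by (simp add: Dz1_div_def Dz1_power_add fun_eq_iff scale_right_distrib)

lemma diagonal_finite_Dz1:
  assumes "diagonal_finite F"
  shows "diagonal_finite (Dz1 scale F)"
  unfolding diagonal_finite_def
proof (intro allI)
  fix \<gamma> i j
  have "{\<gamma>1. Dz1 scale F \<gamma>1 i (\<gamma> - \<gamma>1) j \<noteq> 0} \<subseteq>
      {\<gamma>1. F (\<gamma>1 + 1) i (\<gamma> - \<gamma>1) j \<noteq> 0} \<union> {\<gamma>1. F (\<gamma>1 + 1) (i + 1) (\<gamma> - \<gamma>1) j \<noteq> 0}"
    by (auto simp: Dz1_def Dz_def)
  then show "finite {\<gamma>1. Dz1 scale F \<gamma>1 i (\<gamma> - \<gamma>1) j \<noteq> 0}"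
    using diagonal_finite_shift[OF assms] by (meson finite_Un finite_subset)
qed

lemma diagonal_finite_Dz1_div:
  assumes "diagonal_finite F"
  shows "diagonal_finite (Dz1_div scale n F)"
proof -
  have "diagonal_finite ((Dz1 scale ^^ n) F)"
    by (induction n) (simp_all add: assms diagonal_finite_Dz1)
  then show ?thesis
    by (simp add: diagonal_finite_def Dz1_div_def)
qed

lemma Dz1_mult_z12: "Dz1 scale (mult_z12 F) = mult_z12 (Dz1 scale F) + F"
  by (simp add: Dz1_def Dz_def mult_z12_def fun_eq_iff scale_right_diff_distrib
      scale_left_distrib algebra_simps)

lemma Dz1_scale:
  "Dz1 scale (\<lambda>\<gamma>1 k1 \<gamma>2 k2. scale c (F \<gamma>1 k1 \<gamma>2 k2)) =
   (\<lambda>\<gamma>1 k1 \<gamma>2 k2. scale c (Dz1 scale F \<gamma>1 k1 \<gamma>2 k2))"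
  by (simp add: Dz1_def Dz_def fun_eq_iff scale_right_distrib mult.commute)

lemma Dz1_power_mult_z12:
  "(Dz1 scale ^^ Suc m) (mult_z12 F) = mult_z12 ((Dz1 scale ^^ Suc m) F) +
     (\<lambda>\<gamma>1 k1 \<gamma>2 k2. scale (of_nat (Suc m)) ((Dz1 scale ^^ m) F \<gamma>1 k1 \<gamma>2 k2))"
proof (induction m)
  case 0
  show ?case by (simp add: Dz1_mult_z12 fun_eq_iff)
next
  case (Suc m)
  have "(Dz1 scale ^^ Suc (Suc m)) (mult_z12 F) = Dz1 scale (mult_z12 ((Dz1 scale ^^ Suc m) F)) +
     (\<lambda>\<gamma>1 k1 \<gamma>2 k2. scale (of_nat (Suc m)) ((Dz1 scale ^^ Suc m) F \<gamma>1 k1 \<gamma>2 k2))"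
    unfolding funpow.simps(2)[of "Suc m"] o_apply Suc.IH Dz1_add Dz1_scale by simp
  moreover have "scale 2 x = x + x" for x
    using scale_left_distrib[of 1 1 x] by simp
  ultimately show ?case
    by (simp add: Dz1_mult_z12 fun_eq_iff scale_left_distrib algebra_simps)
qed

text \<open>The Leibniz rule, with \<open>D z12 = 1\<close> and \<open>D\<^sup>2 z12 = 0\<close>.\<close>

lemma Dz1_div_Suc_mult_z12:
  "Dz1_div scale (Suc m) (mult_z12 F) = mult_z12 (Dz1_div scale (Suc m) F) + Dz1_div scale m F"
proof -
  have "(1 / fact (Suc m)) * of_nat (Suc m) = (1 / fact m :: complex)"
    by (simp add: divide_simps del: of_nat_Suc)
  then show ?thesis
    unfolding Dz1_div_def Dz1_power_mult_z12
    by (simp add: mult_z12_def fun_eq_iff scale_right_distrib scale_right_diff_distrib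
        del: fact_Suc of_nat_Suc funpow.simps)
qed

lemma diag_Dz1_div_mult_z12:
  assumes "diagonal_finite F"
  shows "diag (Dz1_div scale (Suc m) (mult_z12 F)) = diag (Dz1_div scale m F)"
proof -
  have "diagonal_finite (Dz1_div scale n F)" for n
    by (rule diagonal_finite_Dz1_div[OF assms])
  then show ?thesis
    by (simp add: Dz1_div_Suc_mult_z12 diag_add diag_mult_z12 diagonal_finite_mult_z12)
qed

lemma diag_Dz1_div_mult_z12_power:
  assumes "diagonal_finite F"
  shows "diag (Dz1_div scale (m + j) ((mult_z12 ^^ j) F)) = diag (Dz1_div scale m F)"
  by (induction j) (simp_all add: diag_Dz1_div_mult_z12 diagonal_finite_mult_z12_power assms)

text \<open>Each derivative removes at most one factor \<open>z12\<close>, so some factor remains and vanishes on the diagonal.\<close>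

lemma diag_Dz1_div_mult_z12_power_eq_0:
  assumes "diagonal_finite F" and "m < j"
  shows "diag (Dz1_div scale m ((mult_z12 ^^ j) F)) = 0"
proof -
  define G where "G = (mult_z12 ^^ (j - m - 1)) F"
  have G: "diagonal_finite G"
    unfolding G_def by (rule diagonal_finite_mult_z12_power[OF assms(1)])
  have "(mult_z12 ^^ j) F = (mult_z12 ^^ m) (mult_z12 G)"
    using assms(2) fun_cong[OF funpow_add[of m "Suc (j - m - 1)" mult_z12], of F]
    by (simp add: G_def)
  then have "diag (Dz1_div scale m ((mult_z12 ^^ j) F)) = diag (Dz1_div scale 0 (mult_z12 G))"
    using diag_Dz1_div_mult_z12_power[OF diagonal_finite_mult_z12[OF G], of 0 m] by simp
  also have "\<dots> = 0"
    using diag_mult_z12[OF G] by (simp add: Dz1_div_def)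
  finally show ?thesis .
qed

end

section \<open>Exponents of logarithmic fields\<close>

text \<open>
  A series in a finite sum of the spaces \<open>W[\<zeta>][[z]]z^(-\<alpha>)\<close> has its exponents in finitely many
  progressions \<open>c, c+1, c+2, \<dots>\<close>; the set \<open>C\<close> collects their starting points.
\<close>

definition exponents_from :: "complex set \<Rightarrow> complex set" where
  "exponents_from C = {c + of_nat i | c i. c \<in> C}"

lemma exponents_from_add_1: "\<gamma> - 1 \<in> exponents_from C \<Longrightarrow> \<gamma> \<in> exponents_from C"
  unfolding exponents_from_def
  by clarsimp (metis add.assoc add.commute diff_add_cancel of_nat_Suc)

lemma finite_exponents_from_bounded:
  assumes "finite C"
  shows "finite {\<gamma> \<in> exponents_from C. Re \<gamma> \<le> r}"
proof -
  have "{\<gamma> \<in> exponents_from C. Re \<gamma> \<le> r} \<subseteq> (\<Union>c\<in>C. (\<lambda>i. c + of_nat i) ` {..nat \<lfloor>r - Re c\<rfloor>})"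
    by (fastforce simp: exponents_from_def le_nat_iff le_floor_iff)
  then show ?thesis
    using assms by (meson finite_UN_I finite_atMost finite_imageI finite_subset)
qed

lemma finite_exponents_from_reflect:
  assumes "finite C"
  shows "finite {\<gamma>1. \<gamma> - \<gamma>1 \<in> exponents_from C \<and> Re \<gamma>1 \<ge> r}"
proof -
  have "{\<gamma>1. \<gamma> - \<gamma>1 \<in> exponents_from C \<and> Re \<gamma>1 \<ge> r}
      \<subseteq> (\<lambda>x. \<gamma> - x) ` {x \<in> exponents_from C. Re x \<le> Re \<gamma> - r}"
    by (auto intro!: image_eqI[where x = "\<gamma> - _"])
  then show ?thesis
    using finite_exponents_from_bounded[OF assms] finite_surj by blast
qed

lemma exponents_from_bounded_below:
  assumes "finite C"
  shows "\<exists>r. \<forall>\<gamma>\<in>exponents_from C. Re \<gamma> \<ge> r"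
proof -
  obtain r where "\<forall>c\<in>C. r \<le> Re c"
    using bdd_below_finite[of "Re ` C"] assms by (auto simp: bdd_below_def)
  then show ?thesis
    by (intro exI[of _ r]) (fastforce simp: exponents_from_def)
qed

lemma diagonal_finite_if_exponents_from:
  assumes "finite C" "finite E"
    and "\<And>\<gamma>1 i \<gamma>2 j. F \<gamma>1 i \<gamma>2 j \<noteq> 0 \<Longrightarrow> \<gamma>1 \<in> exponents_from C \<and> \<gamma>2 \<in> exponents_from E"
  shows "diagonal_finite F"
proof -
  obtain r where r: "\<forall>\<gamma>\<in>exponents_from C. Re \<gamma> \<ge> r"
    using exponents_from_bounded_below[OF assms(1)] by blast
  have "{\<gamma>1. F \<gamma>1 i (\<gamma> - \<gamma>1) j \<noteq> 0} \<subseteq> {\<gamma>1. \<gamma> - \<gamma>1 \<in> exponents_from E \<and> Re \<gamma>1 \<ge> r}" for \<gamma> i j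
    using r assms(3) by blast
  then show ?thesis
    unfolding diagonal_finite_def
    using finite_exponents_from_reflect[OF assms(2)] finite_subset by meson
qed

lemma mult_z12_power_exponents_1:
  fixes F :: "'w::ab_group_add series2"
  assumes "\<And>\<gamma>1 i \<gamma>2 j. F \<gamma>1 i \<gamma>2 j \<noteq> 0 \<Longrightarrow> \<gamma>1 \<in> exponents_from C"
  shows "(mult_z12 ^^ n) F \<gamma>1 i \<gamma>2 j \<noteq> 0 \<Longrightarrow> \<gamma>1 \<in> exponents_from C"
proof (induction n arbitrary: \<gamma>1 i \<gamma>2 j)
  case (Suc n)
  from Suc.prems have "(mult_z12 ^^ n) F (\<gamma>1 - 1) i \<gamma>2 j \<noteq> 0 \<or> (mult_z12 ^^ n) F \<gamma>1 i (\<gamma>2 - 1) j \<noteq> 0"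
    by (auto simp: mult_z12_def[of "(mult_z12 ^^ n) F"])
  then show ?case
  proof
    assume "(mult_z12 ^^ n) F (\<gamma>1 - 1) i \<gamma>2 j \<noteq> 0"
    from Suc.IH[OF this] show ?thesis by (simp add: exponents_from_add_1)
  next
    assume "(mult_z12 ^^ n) F \<gamma>1 i (\<gamma>2 - 1) j \<noteq> 0"
    from Suc.IH[OF this] show ?thesis by (simp add: exponents_from_add_1)
  qed
qed (use assms in simp)

lemma mult_z12_power_exponents_2:
  fixes F :: "'w::ab_group_add series2"
  assumes "\<And>\<gamma>1 i \<gamma>2 j. F \<gamma>1 i \<gamma>2 j \<noteq> 0 \<Longrightarrow> \<gamma>2 \<in> exponents_from C"
  shows "(mult_z12 ^^ n) F \<gamma>1 i \<gamma>2 j \<noteq> 0 \<Longrightarrow> \<gamma>2 \<in> exponents_from C"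
proof (induction n arbitrary: \<gamma>1 i \<gamma>2 j)
  case (Suc n)
  from Suc.prems have "(mult_z12 ^^ n) F (\<gamma>1 - 1) i \<gamma>2 j \<noteq> 0 \<or> (mult_z12 ^^ n) F \<gamma>1 i (\<gamma>2 - 1) j \<noteq> 0"
    by (auto simp: mult_z12_def[of "(mult_z12 ^^ n) F"])
  then show ?case
  proof
    assume "(mult_z12 ^^ n) F (\<gamma>1 - 1) i \<gamma>2 j \<noteq> 0"
    from Suc.IH[OF this] show ?thesis by (simp add: exponents_from_add_1)
  next
    assume "(mult_z12 ^^ n) F \<gamma>1 i (\<gamma>2 - 1) j \<noteq> 0"
    from Suc.IH[OF this] show ?thesis by (simp add: exponents_from_add_1)
  qed
qed (use assms in simp)

lemma sum_field_apply: "(\<Sum>\<alpha>\<in>A. f \<alpha>) v \<gamma> k = (\<Sum>\<alpha>\<in>A. f \<alpha> v \<gamma> k)"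
  for f :: "complex set \<Rightarrow> 'w::ab_group_add field1"
  by (induction A rule: infinite_finite_induct) simp_all

lemma LFie_exponents:
  assumes "a \<in> LFie s"
  obtains C where "finite C" "\<And>\<gamma> k. a v \<gamma> k \<noteq> 0 \<Longrightarrow> \<gamma> \<in> exponents_from C"
proof -
  obtain A f where A: "finite A" "\<forall>\<alpha>\<in>A. f \<alpha> \<in> LFie_at s \<alpha>" and a: "a = (\<Sum>\<alpha>\<in>A. f \<alpha>)"
    using assms by (auto simp: LFie_def)
  have "\<forall>\<alpha>\<in>A. \<exists>m. \<forall>\<gamma> k. f \<alpha> v \<gamma> k \<noteq> 0 \<longrightarrow> (\<exists>i::nat. \<gamma> = of_nat i - m)"
    using A(2) by (fastforce simp: LFie_at_def log_series_def)
  then obtain m where m: "\<forall>\<alpha>\<in>A. \<forall>\<gamma> k. f \<alpha> v \<gamma> k \<noteq> 0 \<longrightarrow> (\<exists>i::nat. \<gamma> = of_nat i - m \<alpha>)"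
    by metis
  have "\<gamma> \<in> exponents_from ((\<lambda>\<alpha>. - m \<alpha>) ` A)" if nz: "a v \<gamma> k \<noteq> 0" for \<gamma> k
  proof -
    obtain \<alpha> where \<alpha>: "\<alpha> \<in> A" "f \<alpha> v \<gamma> k \<noteq> 0"
      using nz unfolding a sum_field_apply by (meson sum.neutral)
    then obtain i :: nat where "\<gamma> = - m \<alpha> + of_nat i"
      using m by fastforce
    then show ?thesis
      using \<alpha>(1) unfolding exponents_from_def by blast
  qed
  then show ?thesis
    using that[of "(\<lambda>\<alpha>. - m \<alpha>) ` A"] A(1) by blast
qed

context complex_vector_space
begin

lemma LFie_linear:
  assumes "b \<in> LFie scale"
  shows "Vector_Spaces.linear scale scale (\<lambda>w. b w \<gamma> j)"
proof -
  obtain A f where A: "\<forall>\<alpha>\<in>A. f \<alpha> \<in> LFie_at scale \<alpha>" and b: "b = (\<Sum>\<alpha>\<in>A. f \<alpha>)"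
    using assms by (auto simp: LFie_def)
  have hom: "module_hom scale (\<lambda>c f \<gamma> k. scale c (f \<gamma> k)) (f \<alpha>)" if "\<alpha> \<in> A" for \<alpha>
    using A that by (auto simp: LFie_at_def linear_iff_module_hom)
  have "b (x + y) \<gamma> j = b x \<gamma> j + b y \<gamma> j" for x y
    unfolding b sum_field_apply using module_hom.add[OF hom]
    by (simp flip: sum.distrib)
  moreover have "b (scale c x) \<gamma> j = scale c (b x \<gamma> j)" for c x
    unfolding b sum_field_apply using module_hom.scale[OF hom]
    by (simp add: scale_sum_right)
  ultimately show ?thesis
    by unfold_locales simp_all
qed

lemma LFie_zero:
  assumes "b \<in> LFie scale"
  shows "b 0 \<gamma> j = 0"
  using module_hom.zero[OF LFie_linear[OF assms, unfolded linear_iff_module_hom]] .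

text \<open>
  In \<open>a(z1) b(z2) v\<close> the exponents of \<open>z2\<close> are those of \<open>b(z2) v\<close>, but the exponents of \<open>z1\<close> have no
  common lower bound; in \<open>b(z2) a(z1) v\<close> it is the other way round. By locality, the two agree after
  multiplication by \<open>z12^N\<close>, which preserves both bounds.
\<close>

lemma diagonal_finite_local:
  assumes a: "a \<in> LFie scale" and b: "b \<in> LFie scale" and loc: "local_with N a b"
  shows "diagonal_finite ((mult_z12 ^^ N) (prod12 a b v))"
proof -
  obtain C where C: "finite C" "\<And>\<gamma> k. a v \<gamma> k \<noteq> 0 \<Longrightarrow> \<gamma> \<in> exponents_from C"
    using LFie_exponents[OF a] by metis
  obtain E where E: "finite E" "\<And>\<gamma> k. b v \<gamma> k \<noteq> 0 \<Longrightarrow> \<gamma> \<in> exponents_from E"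
    using LFie_exponents[OF b] by metis
  have zero_a: "w \<noteq> 0" if "a w \<gamma> j \<noteq> 0" for w \<gamma> j
    using that LFie_zero[OF a, of \<gamma> j] by (cases "w = 0") simp_all
  have zero_b: "w \<noteq> 0" if "b w \<gamma> j \<noteq> 0" for w \<gamma> j
    using that LFie_zero[OF b, of \<gamma> j] by (cases "w = 0") simp_all
  have 1: "\<gamma>1 \<in> exponents_from C" if "prod21 b a v \<gamma>1 i \<gamma>2 j \<noteq> 0" for \<gamma>1 i \<gamma>2 j
    using that C(2) zero_b unfolding prod21_def by blast
  have 2: "\<gamma>2 \<in> exponents_from E" if "prod12 a b v \<gamma>1 i \<gamma>2 j \<noteq> 0" for \<gamma>1 i \<gamma>2 j
    using that E(2) zero_a unfolding prod12_def by blast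
  have eq: "(mult_z12 ^^ N) (prod12 a b v) = (mult_z12 ^^ N) (prod21 b a v)"
    using loc by (simp add: local_with_def)
  show ?thesis
  proof (rule diagonal_finite_if_exponents_from[OF C(1) E(1)])
    fix \<gamma>1 i \<gamma>2 j
    assume nz: "(mult_z12 ^^ N) (prod12 a b v) \<gamma>1 i \<gamma>2 j \<noteq> 0"
    show "\<gamma>1 \<in> exponents_from C \<and> \<gamma>2 \<in> exponents_from E"
    proof
      show "\<gamma>1 \<in> exponents_from C"
        by (rule mult_z12_power_exponents_1[OF _ nz[unfolded eq]]) (rule 1)
      show "\<gamma>2 \<in> exponents_from E"
        by (rule mult_z12_power_exponents_2[OF _ nz]) (rule 2)
    qed
  qed
qed

text \<open>
  The creation part bounds the exponents of \<open>z1\<close> below by zero in the first term; in the second,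
  the annihilation part of \<open>a(z1) v\<close> has only finitely many exponents.
\<close>

lemma diagonal_finite_normal_prod:
  assumes a: "a \<in> LFie scale" and b: "b \<in> LFie scale"
  shows "diagonal_finite (normal_prod a b v)"
proof -
  obtain C where C: "finite C" "\<And>\<gamma> k. a v \<gamma> k \<noteq> 0 \<Longrightarrow> \<gamma> \<in> exponents_from C"
    using LFie_exponents[OF a] by metis
  obtain E where E: "finite E" "\<And>\<gamma> k. b v \<gamma> k \<noteq> 0 \<Longrightarrow> \<gamma> \<in> exponents_from E"
    using LFie_exponents[OF b] by metis
  have zero_a: "w \<noteq> 0" if "a w \<gamma> j \<noteq> 0" for w \<gamma> j
    using that LFie_zero[OF a, of \<gamma> j] by (cases "w = 0") simp_all
  have zero_b: "w \<noteq> 0" if "b w \<gamma> j \<noteq> 0" for w \<gamma> j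
    using that LFie_zero[OF b, of \<gamma> j] by (cases "w = 0") simp_all
  have "{\<gamma>1. prod12 (creation a) b v \<gamma>1 i (\<gamma> - \<gamma>1) j \<noteq> 0}
      \<subseteq> {\<gamma>1. \<gamma> - \<gamma>1 \<in> exponents_from E \<and> Re \<gamma>1 \<ge> 0}" for \<gamma> i j
  proof clarify
    fix \<gamma>1 assume nz: "prod12 (creation a) b v \<gamma>1 i (\<gamma> - \<gamma>1) j \<noteq> 0"
    then have "Re \<gamma>1 \<ge> 0"
      by (auto simp: prod12_def creation_def split: if_splits)
    moreover have "b v (\<gamma> - \<gamma>1) j \<noteq> 0"
      by (rule zero_a[of _ \<gamma>1 i]) (use nz in \<open>auto simp: prod12_def creation_def split: if_splits\<close>)
    ultimately show "\<gamma> - \<gamma>1 \<in> exponents_from E \<and> Re \<gamma>1 \<ge> 0"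
      using E(2) by blast
  qed
  then have "diagonal_finite (prod12 (creation a) b v)"
    unfolding diagonal_finite_def
    using finite_exponents_from_reflect[OF E(1)] finite_subset by meson
  moreover have "{\<gamma>1. prod21 b (annihilation a) v \<gamma>1 i (\<gamma> - \<gamma>1) j \<noteq> 0}
      \<subseteq> {\<gamma>1 \<in> exponents_from C. Re \<gamma>1 \<le> 0}" for \<gamma> i j
  proof clarify
    fix \<gamma>1 assume "prod21 b (annihilation a) v \<gamma>1 i (\<gamma> - \<gamma>1) j \<noteq> 0"
    then have "annihilation a v \<gamma>1 i \<noteq> 0"
      using zero_b unfolding prod21_def by blast
    then show "\<gamma>1 \<in> exponents_from C \<and> Re \<gamma>1 \<le> 0"
      using C(2) by (auto simp: annihilation_def split: if_splits)
  qed
  then have "diagonal_finite (prod21 b (annihilation a) v)"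
    unfolding diagonal_finite_def
    using finite_exponents_from_bounded[OF C(1)] finite_subset by meson
  ultimately show ?thesis
    unfolding normal_prod_def by (rule diagonal_finite_add)
qed

section \<open>Products of local fields\<close>

text \<open>
  The exponent \<open>M\<close> picked by the definition may differ from \<open>N\<close>. Passing from the smaller to the larger
  one multiplies by a power of \<open>z12\<close> and differentiates as many times more, which changes nothing on
  the diagonal. If \<open>M \<le> n < N\<close>, the definition gives zero; so does the formula with \<open>N\<close>, which applies
  fewer than \<open>N - M\<close> derivatives to a multiple of \<open>z12^(N-M)\<close>.
\<close>

lemma nth_product_eq:
  assumes a: "a \<in> LFie scale" and b: "b \<in> LFie scale" and loc: "local_with N a b"
    and n: "n \<le> int N - 1"
  shows "nth_product scale a b n =
    (\<lambda>v. diag (Dz1_div scale (nat (int N - 1 - n)) ((mult_z12 ^^ N) (prod12 a b v))))"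
proof -
  define M where "M = (SOME N. local_with N a b)"
  have locM: "local_with M a b"
    unfolding M_def using loc by (rule someI)
  define F where "F K v = (mult_z12 ^^ K) (prod12 a b v)" for K v
  have fin: "diagonal_finite (F K v)" if "local_with K a b" for K v
    unfolding F_def by (rule diagonal_finite_local[OF a b that])
  have step: "F L v = (mult_z12 ^^ (L - K)) (F K v)" if "K \<le> L" for K L v
    using that fun_cong[OF funpow_add[of "L - K" K mult_z12]] by (simp add: F_def)
  have indep: "diag (Dz1_div scale (nat (int L - 1 - n)) (F L v)) =
      diag (Dz1_div scale (nat (int K - 1 - n)) (F K v))"
    if "K \<le> L" "n \<le> int K - 1" "local_with K a b" for K L v
  proof -
    have "nat (int L - 1 - n) = nat (int K - 1 - n) + (L - K)"
      using that by simp
    then show ?thesis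
      using diag_Dz1_div_mult_z12_power[OF fin[OF that(3)]] step[OF that(1)] by simp
  qed
  have "nth_product scale a b n = (if n \<le> int M - 1
      then (\<lambda>v. diag (Dz1_div scale (nat (int M - 1 - n)) (F M v))) else 0)"
    by (simp add: nth_product_def M_def F_def Let_def)
  also have "\<dots> = (\<lambda>v. diag (Dz1_div scale (nat (int N - 1 - n)) (F N v)))"
  proof (cases "n \<le> int M - 1")
    case True
    then show ?thesis
      using indep[of M N] indep[of N M] n loc locM by (cases "M \<le> N") auto
  next
    case False
    then have "M \<le> N" "nat (int N - 1 - n) < N - M"
      using n by auto
    then have "diag (Dz1_div scale (nat (int N - 1 - n)) (F N v)) = 0" for v
      using diag_Dz1_div_mult_z12_power_eq_0[OF fin[OF locM]] step[of M N] by simp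
    then show ?thesis
      using False by auto
  qed
  finally show ?thesis
    by (simp add: F_def)
qed

lemma nth_product_eq_propagator_plus_normal_prod:
  assumes a: "a \<in> LFie scale" and b: "b \<in> LFie scale" and loc: "local_with N a b"
    and n: "n \<le> int N - 1"
  shows "nth_product scale a b n v =
      diag (Dz1_div scale (nat (int N - 1 - n)) ((mult_z12 ^^ N) (propagator a b v))) +
      diag (Dz1_div scale (nat (int N - 1 - n)) ((mult_z12 ^^ N) (normal_prod a b v)))"
proof -
  have split: "(mult_z12 ^^ N) (prod12 a b v) =
      (mult_z12 ^^ N) (propagator a b v) + (mult_z12 ^^ N) (normal_prod a b v)"
    by (simp add: propagator_eq flip: mult_z12_power_add)
  have norm: "diagonal_finite ((mult_z12 ^^ N) (normal_prod a b v))"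
    by (intro diagonal_finite_mult_z12_power diagonal_finite_normal_prod a b)
  have "diagonal_finite ((mult_z12 ^^ N) (propagator a b v))"
    using diagonal_finite_minus[OF diagonal_finite_local[OF a b loc, of v] norm] by (simp add: split)
  then show ?thesis
    using norm by (simp add: nth_product_eq[OF a b loc n] split Dz1_div_add diag_add
        diagonal_finite_Dz1_div)
qed

end

theorem proposition3p6:
  fixes scale :: "complex \<Rightarrow> 'w::ab_group_add \<Rightarrow> 'w"
    and a b :: "'w field1" and N :: nat
  assumes "vector_space scale"
    and "a \<in> LFie scale" and "b \<in> LFie scale"
    and "mutually_local a b"
    and "local_with N a b"
  shows "(\<forall>n::int. 0 \<le> n \<and> n \<le> int N - 1 \<longrightarrow>
            nth_product scale a b n =
              (\<lambda>v. diag (Dz1_div scale (nat (int N - 1 - n)) ((mult_z12 ^^ N) (propagator a b v))))) \<and>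
         (\<forall>k::nat.
            nth_product scale a b (- int k - 1) =
              (\<lambda>v. diag (normal_prod_deriv scale k a b v) +
                   diag (Dz1_div scale (N + k) ((mult_z12 ^^ N) (propagator a b v)))))"
proof -
  interpret complex_vector_space scale
    using assms(1) by (simp add: complex_vector_space_def)
  note a = assms(2) and b = assms(3) and loc = assms(5)
  note product = nth_product_eq_propagator_plus_normal_prod[OF a b loc]
  have normal: "diagonal_finite (normal_prod a b v)" for v
    by (rule diagonal_finite_normal_prod[OF a b])
  show ?thesis
  proof (intro conjI allI impI)
    fix n :: int
    assume n: "0 \<le> n \<and> n \<le> int N - 1"
    then have "nat (int N - 1 - n) < N"
      by linarith
    then show "nth_product scale a b n =
        (\<lambda>v. diag (Dz1_div scale (nat (int N - 1 - n)) ((mult_z12 ^^ N) (propagator a b v))))"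
      \<comment> \<open>Extensionality in \<open>v\<close> only: the identities are between whole series.\<close>
      using n by (intro ext[of "nth_product scale a b n"])
        (simp add: product diag_Dz1_div_mult_z12_power_eq_0[OF normal])
  next
    fix k :: nat
    have "nat (int N - 1 - (- int k - 1)) = k + N"
      by linarith
    moreover have "diag (Dz1_div scale (k + N) ((mult_z12 ^^ N) (normal_prod a b v))) =
        diag (normal_prod_deriv scale k a b v)" for v
      by (simp add: diag_Dz1_div_mult_z12_power[OF normal] Dz1_div_normal_prod[OF LFie_linear[OF b]])
    ultimately show "nth_product scale a b (- int k - 1) =
        (\<lambda>v. diag (normal_prod_deriv scale k a b v) +
             diag (Dz1_div scale (N + k) ((mult_z12 ^^ N) (propagator a b v))))"
      by (intro ext[of "nth_product scale a b (- int k - 1)"]) (simp add: product add.commute)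
  qed
qed

end
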